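(* Let $f_1,\dots,f_n,h_1,\dots,h_k$ be functions such that $\mathcal{W}(g_1,\dots,g_m)\ne0$ for any subset $\{g_1,\dots,g_m\}$ of $\{f_1,\dots,f_n,h_1,\dots,h_k\}$. Let $S$ and $\widehat S$ be the monic linear difference operators of orders $n$ and $n+k$ annihilating $f_1,\dots,f_n$ and $f_1,\dots,f_n,h_1,\dots,h_k$, respectively, and let $\check S$ be the unique difference operator such that $\widehat S=\check SS$. Put $$\phi_a=T\left(\frac{\mathcal{W}(f_1,\dots,f_n,h_1,\dots,h_{a-1},h_{a+1},\dots,h_k)}{\mathcal{W}(f_1,\dots,f_n,h_1,\dots,h_k)}\right),\quad a=1,\dots,k.$$ Then $\check S^\dagger\phi_a=0$ for all $a=1,\dots,k$.
   Context: Functions are functions of a variable $x$. $(Tf)(x)=f(x+1)$, $T_-=T^{-1}$, so $(T_-f)(x)=f(x-1)$. $\mathcal{W}(g_1,\dots,g_m)=\det\big((T^{j-1}g_i)_{i,j=1}^m\big)$ is the discrete Wronskian. A linear difference operator of order $N$ is $S=\sum_{i=0}^Na_i(x)T^{N-i}$, where $a_0,\dots,a_N$ are complex valued functions of $x$ and $a_0\ne0$; it is monic if $a_0=1$. The formal conjugate of $S=\sum_{i=0}^Na_i(x)T^{N-i}$ is the operator $S^\dagger$ acting by $S^\dagger h(x)=\sum_{i=0}^N(T_-)^{N-i}\big(a_i(x)h(x)\big)$. Under the stated hypothesis the monic operators $S$, $\widehat S$ of the indicated orders exist and are unique, and $\check S$ exists and is unique. *)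

theory Defs
  imports Complex_Main "Jordan_Normal_Form.Determinant"
begin

text \<open>
  Functions of \<open>x\<close> are total functions on the complex numbers of which only the values on a
  shift-invariant set \<open>D\<close> (\<open>D + 1 = D\<close>) matter; identities between functions and operators are
  identities on \<open>D\<close>.  \<open>D = UNIV\<close> gives functions defined on all of the complex plane.  For
  finitely many meromorphic functions, let \<open>D\<close> be the complement of all integer translates of
  their poles and of the zeros of their (not identically zero) Wronskians.
\<close>

definition shift :: "(complex \<Rightarrow> complex) \<Rightarrow> complex \<Rightarrow> complex" where
  "shift f = (\<lambda>x. f (x + 1))"

definition unshift :: "(complex \<Rightarrow> complex) \<Rightarrow> complex \<Rightarrow> complex" where
  "unshift f = (\<lambda>x. f (x - 1))"

definition shift_invariant :: "complex set \<Rightarrow> bool" where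
  "shift_invariant D \<longleftrightarrow> (\<forall>x. x + 1 \<in> D \<longleftrightarrow> x \<in> D)"

text \<open>Rows and columns are numbered from 0, so column \<open>j\<close> carries the \<open>j\<close>-th power of the shift.
  The Wronskian of the empty list is 1.\<close>

definition wronskian :: "(complex \<Rightarrow> complex) list \<Rightarrow> complex \<Rightarrow> complex" where
  "wronskian gs = (\<lambda>x. det (mat (length gs) (length gs) (\<lambda>(i, j). (shift ^^ j) (gs ! i) x)))"

text \<open>
  A difference operator of order \<open>N\<close> is given by \<open>N\<close> and its coefficients \<open>a 0, \<dots>, a N\<close>, where
  \<open>a i\<close> belongs to the power \<open>N - i\<close> of the shift; \<open>a i\<close> for \<open>i > N\<close> is never used.
\<close>

definition diff_op :: "nat \<Rightarrow> (nat \<Rightarrow> complex \<Rightarrow> complex) \<Rightarrow> (complex \<Rightarrow> complex) \<Rightarrow> complex \<Rightarrow> complex" where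
  "diff_op N a u = (\<lambda>x. \<Sum>i\<le>N. a i x * (shift ^^ (N - i)) u x)"

definition diff_op_conj :: "nat \<Rightarrow> (nat \<Rightarrow> complex \<Rightarrow> complex) \<Rightarrow> (complex \<Rightarrow> complex) \<Rightarrow> complex \<Rightarrow> complex" where
  "diff_op_conj N a h = (\<lambda>x. \<Sum>i\<le>N. (unshift ^^ (N - i)) (\<lambda>y. a i y * h y) x)"

text \<open>The leading coefficient of an operator is only required not to be the zero function on \<open>D\<close>.\<close>

definition leading_nonzero :: "complex set \<Rightarrow> (nat \<Rightarrow> complex \<Rightarrow> complex) \<Rightarrow> bool" where
  "leading_nonzero D a \<longleftrightarrow> (\<exists>x\<in>D. a 0 x \<noteq> 0)"

definition monic_op :: "complex set \<Rightarrow> (nat \<Rightarrow> complex \<Rightarrow> complex) \<Rightarrow> bool" where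
  "monic_op D a \<longleftrightarrow> (\<forall>x\<in>D. a 0 x = 1)"

definition annihilates ::
  "complex set \<Rightarrow> nat \<Rightarrow> (nat \<Rightarrow> complex \<Rightarrow> complex) \<Rightarrow> (complex \<Rightarrow> complex) list \<Rightarrow> bool" where
  "annihilates D N a gs \<longleftrightarrow> (\<forall>g\<in>set gs. \<forall>x\<in>D. diff_op N a g x = 0)"

text \<open>
  Equality of the operator of order \<open>N\<close> with the composition of those of orders \<open>M\<close> and \<open>L\<close>,
  as operators on all functions on \<open>D\<close>.  As \<open>x, x + 1, x + 2, \<dots>\<close> are distinct, this is the same
  as equality of the coefficients at each power of the shift.
\<close>

definition op_factorization ::
  "complex set \<Rightarrow> nat \<Rightarrow> (nat \<Rightarrow> complex \<Rightarrow> complex) \<Rightarrow> nat \<Rightarrow> (nat \<Rightarrow> complex \<Rightarrow> complex) \<Rightarrow>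
   nat \<Rightarrow> (nat \<Rightarrow> complex \<Rightarrow> complex) \<Rightarrow> bool" where
  "op_factorization D N c M b L a \<longleftrightarrow>
     (\<forall>u. \<forall>x\<in>D. diff_op N c u x = diff_op M b (diff_op L a u) x)"

text \<open>With 0-based \<open>a\<close>, the function \<open>hs ! a\<close> is omitted in the numerator.\<close>

definition phi ::
  "(complex \<Rightarrow> complex) list \<Rightarrow> (complex \<Rightarrow> complex) list \<Rightarrow> nat \<Rightarrow> complex \<Rightarrow> complex" where
  "phi fs hs a =
     shift (\<lambda>x. wronskian (fs @ take a hs @ drop (Suc a) hs) x / wronskian (fs @ hs) x)"

end

theory Submission
  imports Defs
begin

text \<open>
  Let \<open>g\<^sub>a = S h\<^sub>a\<close>.  Adding multiples of preceding columns turns the Wronskian matrix of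
  \<open>f\<^sub>1, \<dots>, f\<^sub>n, h\<^sub>1, \<dots>, h\<^sub>k\<close> into a block triangular one whose diagonal blocks are the
  Wronskian matrices of the \<open>f\<^sub>i\<close> and of the \<open>g\<^sub>a\<close>; hence \<open>W(f, h) = W(f) W(g)\<close>, and \<open>\<phi>\<^sub>a\<close> is the shift
  of the quotient of \<open>W(g\<^sub>1, \<dots>, g\<^sub>k)\<close> without \<open>g\<^sub>a\<close> by \<open>W(g\<^sub>1, \<dots>, g\<^sub>k)\<close>.  The quotient
  operator is monic of order \<open>k\<close> and annihilates all \<open>g\<^sub>a\<close>, so that the Wronskian matrix \<open>G\<close> of the \<open>g\<^sub>a\<close>
  satisfies \<open>G(x + 1) = G(x) C(x)\<close> with the companion matrix \<open>C\<close>.  Up to sign, \<open>\<phi>\<^sub>a(x - 1)\<close> is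
  an entry of the last row of \<open>G(x)\<^sup>-\<^sup>1 = C(x) G(x + 1)\<^sup>-\<^sup>1\<close>; eliminating the other rows from this
  recursion gives the conjugate equation.
\<close>

section \<open>Pointwise form of shifts, operators and conjugates\<close>

lemma shift_funpow: "(shift ^^ j) f x = f (x + of_nat j)"
  by (induction j arbitrary: x) (simp_all add: shift_def algebra_simps)

lemma unshift_funpow: "(unshift ^^ j) f x = f (x - of_nat j)"
  by (induction j arbitrary: x) (simp_all add: unshift_def algebra_simps)

lemma shift_invariant_add:
  assumes "shift_invariant D" and "x \<in> D"
  shows "x + of_nat j \<in> D"
  using assms by (induction j) (auto simp: shift_invariant_def add.assoc[symmetric] add.commute[of 1])

lemma shift_invariant_diff:
  assumes "shift_invariant D" and "x \<in> D"
  shows "x - of_nat j \<in> D"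
proof (induction j)
  case (Suc j)
  have "x - of_nat (Suc j) + 1 = x - of_nat j" by simp
  then show ?case using Suc assms(1) unfolding shift_invariant_def by metis
qed (use assms in simp)

lemma diff_op_altdef: "diff_op N a u x = (\<Sum>l\<le>N. a (N - l) x * u (x + of_nat l))"
  unfolding diff_op_def shift_funpow
  by (rule sum.reindex_bij_witness[of _ "\<lambda>l. N - l" "\<lambda>l. N - l"]) auto

lemma diff_op_conj_altdef:
  "diff_op_conj N a h x = (\<Sum>l\<le>N. a (N - l) (x - of_nat l) * h (x - of_nat l))"
  unfolding diff_op_conj_def unshift_funpow
  by (rule sum.reindex_bij_witness[of _ "\<lambda>l. N - l" "\<lambda>l. N - l"]) auto

section \<open>Factorization of Wronskians\<close>

definition wronski_mat :: "(complex \<Rightarrow> complex) list \<Rightarrow> complex \<Rightarrow> complex mat" where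
  "wronski_mat gs x = mat (length gs) (length gs) (\<lambda>(i, j). (gs ! i) (x + of_nat j))"

lemma wronski_mat_carrier [simp]:
  "wronski_mat gs x \<in> carrier_mat (length gs) (length gs)"
  by (simp add: wronski_mat_def)

lemma wronskian_altdef: "wronskian gs x = det (wronski_mat gs x)"
  by (simp add: wronskian_def wronski_mat_def shift_funpow)

lemma wronskian_append_eq_mult:
  assumes D: "shift_invariant D" and s: "monic_op D s"
    and ann: "annihilates D (length fs) s fs" and x: "x \<in> D"
  shows "wronskian (fs @ hs) x = wronskian fs x * wronskian (map (diff_op (length fs) s) hs) x"
proof -
  define n where "n = length fs"
  define k where "k = length hs"
  define W where "W = wronski_mat (fs @ hs) x"
  \<comment> \<open>Column \<open>n + t\<close> of \<open>U\<close> lists the coefficients of the \<open>t\<close>-th shift of the operator \<open>s\<close>.\<close>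
  define U where "U = mat (n + k) (n + k) (\<lambda>(l, j). if j < n then (if l = j then 1 else 0)
     else if j - n \<le> l \<and> l \<le> j then s (j - l) (x + of_nat (j - n)) else 0)"
  define C where "C = mat k n (\<lambda>(i, j). (hs ! i) (x + of_nat j))"
  let ?gs = "map (diff_op n s) hs"
  have W: "W \<in> carrier_mat (n + k) (n + k)"
    unfolding W_def by (metis wronski_mat_carrier length_append n_def k_def)
  have U: "U \<in> carrier_mat (n + k) (n + k)" by (simp add: U_def)
  have U_diag: "U $$ (i, i) = 1" if "i < n + k" for i
    using that shift_invariant_add[OF D x] s by (auto simp: U_def monic_op_def simp del: of_nat_diff)
  have "det U = prod_list (diag_mat U)"
    by (rule det_upper_triangular[OF _ U]) (auto simp: U_def upper_triangular_def)
  also have "diag_mat U = map (\<lambda>i. 1) [0..<n + k]"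
    using U U_diag by (auto simp: diag_mat_def)
  also have "prod_list \<dots> = 1" by (simp add: map_replicate_const prod_list_replicate)
  finally have det_U: "det U = 1" .
  have apply_s: "(W * U) $$ (i, n + t) = diff_op n s ((fs @ hs) ! i) (x + of_nat t)"
    if "i < n + k" "t < k" for i t
  proof -
    have "(W * U) $$ (i, n + t) = (\<Sum>l<n + k. W $$ (i, l) * U $$ (l, n + t))"
      using that W U by (simp add: scalar_prod_def atLeast0LessThan)
    \<comment> \<open>Column \<open>n + t\<close> of \<open>U\<close> is supported on the rows
      \<open>t\<close> to \<open>t + n\<close>.\<close>
    also have "\<dots> = (\<Sum>l\<in>{t..t + n}. W $$ (i, l) * U $$ (l, n + t))"
      using that by (intro sum.mono_neutral_right) (auto simp: U_def)
    also have "\<dots> = (\<Sum>r\<le>n. s (n - r) (x + of_nat t) * ((fs @ hs) ! i) (x + of_nat t + of_nat r))"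
      by (rule sum.reindex_bij_witness[of _ "\<lambda>r. r + t" "\<lambda>l. l - t"])
         (use that in \<open>auto simp: U_def W_def wronski_mat_def n_def k_def add_ac\<close>)
    finally show ?thesis by (simp add: diff_op_altdef)
  qed
  have unchanged: "(W * U) $$ (i, j) = W $$ (i, j)" if "i < n + k" "j < n" for i j
  proof -
    have "(W * U) $$ (i, j) = (\<Sum>l<n + k. W $$ (i, l) * U $$ (l, j))"
      using that W U by (simp add: scalar_prod_def atLeast0LessThan)
    also have "\<dots> = (\<Sum>l<n + k. if l = j then W $$ (i, l) else 0)"
      using that by (intro sum.cong) (auto simp: U_def)
    finally show ?thesis using that by simp
  qed
  have "W * U = four_block_mat (wronski_mat fs x) (0\<^sub>m n k) C (wronski_mat ?gs x)" (is "_ = ?B")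
  proof (rule eq_matI)
    show "dim_row (W * U) = dim_row ?B" "dim_col (W * U) = dim_col ?B"
      using W U by (simp_all add: wronski_mat_def n_def k_def)
    fix i j assume "i < dim_row ?B" "j < dim_col ?B"
    then have i: "i < n + k" and j: "j < n + k" by (simp_all add: wronski_mat_def n_def k_def)
    show "(W * U) $$ (i, j) = ?B $$ (i, j)"
    proof (cases "j < n")
      case True
      then show ?thesis using i unchanged[OF i True]
        by (auto simp: wronski_mat_def W_def C_def n_def k_def nth_append)
    next
      case False
      then obtain t where t: "j = n + t" using le_Suc_ex by force
      then have "t < k" using j by simp
      \<comment> \<open>This gives the zero block: the rows of \<open>fs\<close> vanish in the
        columns from \<open>n\<close> on.\<close>
      have "diff_op n s ((fs @ hs) ! i) (x + of_nat t) = 0" if "i < n"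
        using ann that shift_invariant_add[OF D x]
        by (simp add: annihilates_def n_def nth_append)
      then show ?thesis using i t \<open>t < k\<close> apply_s[OF i \<open>t < k\<close>]
        by (auto simp: wronski_mat_def n_def k_def nth_append)
    qed
  qed
  then have "det (W * U) = det (wronski_mat fs x) * det (wronski_mat ?gs x)"
    by (simp, intro det_four_block_mat_upper_right_zero[where n = n and m = k])
       (auto simp: wronski_mat_def C_def n_def k_def)
  then show ?thesis
    using det_mult[OF W U] det_U by (simp add: wronskian_altdef W_def n_def)
qed

section \<open>The conjugate equation for Wronskian quotients\<close>

lemma mat_delete_wronski_mat:
  assumes "a < length gs"
  shows "mat_delete (wronski_mat gs x) a (length gs - 1) =
    wronski_mat (take a gs @ drop (Suc a) gs) x"
  using assms
  by (intro eq_matI) (auto simp: mat_delete_def wronski_mat_def nth_append min_def)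

lemma diff_op_conj_wronskian_quotient_eq_0:
  assumes D: "shift_invariant D" and b: "monic_op D b"
    and ann: "annihilates D k b gs" and k: "length gs = k" and a: "a < k"
    and nz: "\<And>x. x \<in> D \<Longrightarrow> wronskian gs x \<noteq> 0" and y: "y \<in> D"
  shows "diff_op_conj k b
    (shift (\<lambda>x. wronskian (take a gs @ drop (Suc a) gs) x / wronskian gs x)) y = 0"
proof -
  define p where "p x = wronskian (take a gs @ drop (Suc a) gs) x / wronskian gs x" for x
  define G where "G = wronski_mat gs"
  \<comment> \<open>On \<open>D\<close> this is the inverse of \<open>G x\<close>; the adjugate form
    exposes its entries as cofactors. Below, \<open>c l\<close> is the coefficient of the
    \<open>l\<close>-th shift.\<close>
  define P where "P x = inverse (det (G x)) \<cdot>\<^sub>m adj_mat (G x)" for x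
  define c where "c l = b (k - l)" for l
  have G: "G x \<in> carrier_mat k k" for x by (simp add: G_def k[symmetric])
  have P: "P x \<in> carrier_mat k k" for x using adj_mat(1)[OF G[of x]] by (simp add: P_def)
  have GP: "G x * P x = 1\<^sub>m k" and PG: "P x * G x = 1\<^sub>m k" if "x \<in> D" for x
  proof -
    have "det (G x) \<noteq> 0" using nz[OF that] by (simp add: G_def wronskian_altdef)
    then have "inverse (det (G x)) \<cdot>\<^sub>m (det (G x) \<cdot>\<^sub>m 1\<^sub>m k) = 1\<^sub>m k"
      by (intro eq_matI) auto
    then show "G x * P x = 1\<^sub>m k" "P x * G x = 1\<^sub>m k"
      using adj_mat[OF G[of x]] G[of x]
      by (simp_all add: P_def mult_smult_distrib mult_smult_assoc_mat[where n = k])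
  qed
  \<comment> \<open>Deleting the last column leaves consecutive shifts, so the cofactor is a
    Wronskian up to a sign that does not depend on \<open>x\<close>. Where the determinant vanishes
    both sides are 0.\<close>
  have P_last: "P x $$ (k - 1, a) = (-1) ^ (a + (k - 1)) * p x" for x
    using a k mat_delete_wronski_mat[of a gs x] G[of x]
    by (simp add: P_def p_def adj_mat_def cofactor_def wronskian_altdef G_def field_simps)
  have recur: "(\<Sum>l<k. c l x * g (x + of_nat l)) = - g (x + of_nat k)"
    if "x \<in> D" "g \<in> set gs" for x g
  proof -
    have "(\<Sum>l\<le>k. c l x * g (x + of_nat l)) = 0"
      using ann that by (auto simp: annihilates_def diff_op_altdef c_def)
    moreover have "c k x = 1" using b that by (simp add: monic_op_def c_def)
    ultimately show ?thesis
      by (simp add: lessThan_Suc_atMost[symmetric] add_eq_0_iff)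
  qed
  have P_rec: "P x $$ (i, a) =
      (if i = 0 then 0 else P (x + 1) $$ (i - 1, a)) - c i x * P (x + 1) $$ (k - 1, a)"
    if x: "x \<in> D" and i: "i < k" for x i
  proof -
    \<comment> \<open>\<open>Q\<close> is C(x) \<open>P (x + 1)\<close> written out entrywise: C(x)
      has ones below the diagonal and last column \<open>- c i x\<close>. Being a right inverse of
      \<open>G x\<close>, it equals \<open>P x\<close>.\<close>
    define Q where "Q = mat k k (\<lambda>(i, j).
      (if i = 0 then 0 else P (x + 1) $$ (i - 1, j)) - c i x * P (x + 1) $$ (k - 1, j))"
    have Q: "Q \<in> carrier_mat k k" by (simp add: Q_def)
    have x1: "x + 1 \<in> D" using D x by (simp add: shift_invariant_def)
    have "G x * Q = G (x + 1) * P (x + 1)"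
    proof (rule eq_matI)
      show "dim_row (G x * Q) = dim_row (G (x + 1) * P (x + 1))"
        "dim_col (G x * Q) = dim_col (G (x + 1) * P (x + 1))"
        using G[of x] G[of "x + 1"] P[of "x + 1"] Q by auto
      fix r j assume "r < dim_row (G (x + 1) * P (x + 1))" "j < dim_col (G (x + 1) * P (x + 1))"
      then have r: "r < k" and j: "j < k" using G[of "x + 1"] P[of "x + 1"] by auto
      define g where "g = gs ! r"
      have g: "g \<in> set gs" using r k by (simp add: g_def)
      obtain k' where k': "k = Suc k'" using a by (cases k) auto
      have G_nth: "G z $$ (r, l) = g (z + of_nat l)" if "l < k" for z l
        using r k that by (simp add: G_def wronski_mat_def g_def)
      have "(G x * Q) $$ (r, j) = (\<Sum>l<k. g (x + of_nat l) * Q $$ (l, j))"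
        using r j G[of x] Q by (simp add: scalar_prod_def atLeast0LessThan G_nth)
      also have "\<dots> = (\<Sum>l<k. g (x + of_nat l) * (if l = 0 then 0 else P (x + 1) $$ (l - 1, j)))
          - (\<Sum>l<k. c l x * g (x + of_nat l)) * P (x + 1) $$ (k - 1, j)"
        using j by (simp add: Q_def right_diff_distrib sum_subtractf sum_distrib_left mult_ac)
      \<comment> \<open>The term \<open>l = 0\<close> drops out and the rest is reindexed;
        \<open>recur\<close> supplies the missing last summand \<open>l = k - 1\<close>.\<close>
      also have "\<dots> = (\<Sum>l<k'. g (x + 1 + of_nat l) * P (x + 1) $$ (l, j))
          + g (x + of_nat k) * P (x + 1) $$ (k - 1, j)"
        unfolding recur[OF x g] unfolding k' sum.lessThan_Suc_shift by (simp add: add_ac)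
      also have "\<dots> = (\<Sum>l<k. g (x + 1 + of_nat l) * P (x + 1) $$ (l, j))"
        by (simp add: k' add_ac)
      also have "\<dots> = (G (x + 1) * P (x + 1)) $$ (r, j)"
        using r j G[of "x + 1"] P[of "x + 1"]
        by (simp add: scalar_prod_def atLeast0LessThan G_nth)
      finally show "(G x * Q) $$ (r, j) = (G (x + 1) * P (x + 1)) $$ (r, j)" .
    qed
    then have "G x * Q = 1\<^sub>m k" using GP[OF x1] by simp
    then have "P x = Q"
      using assoc_mult_mat[OF P[of x] G[of x] Q] PG[OF x] P[of x] Q by simp
    then show ?thesis using i a by (simp add: Q_def)
  qed
  \<comment> \<open>Unrolling \<open>P_rec\<close> down to row 0 leaves only entries of the last
    row. Each step moves the argument by 1, hence the induction over all \<open>x\<close>.\<close>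
  have P_sum: "P x $$ (i, a) =
      - (\<Sum>l\<le>i. c (i - l) (x + of_nat l) * P (x + of_nat l + 1) $$ (k - 1, a))"
    if "x \<in> D" "i < k" for x i
    using that
  proof (induction i arbitrary: x)
    case 0
    then show ?case by (simp add: P_rec)
  next
    case (Suc i)
    have "x + 1 \<in> D" using D Suc.prems by (simp add: shift_invariant_def)
    then show ?case
      using Suc by (simp add: P_rec[of x "Suc i"] sum.atMost_Suc_shift add_ac del: sum.atMost_Suc)
  qed
  \<comment> \<open>With row \<open>i = k - 1\<close> the left side of \<open>P_sum\<close> is a
    last-row entry too, which closes the recursion; this \<open>x\<close> makes
    \<open>x + l\<close>, \<open>l < k\<close>, end at \<open>y\<close>.\<close>
  define x where "x = y - of_nat (k - 1)"
  have x: "x \<in> D" unfolding x_def by (rule shift_invariant_diff[OF D y])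
  have x_add: "x + of_nat l = y - of_nat (k - 1 - l)" if "l < k" for l
    using that by (simp add: x_def of_nat_diff)
  have "p x = - (\<Sum>l<k. c (k - 1 - l) (x + of_nat l) * p (x + of_nat l + 1))"
    (is "_ = - ?s")
  proof -
    define e :: complex where "e = (-1) ^ (a + (k - 1))"
    have "{..k - 1} = {..<k}" using a by auto
    then have "e * p x = e * - ?s"
      using P_sum[OF x, of "k - 1", unfolded P_last, folded e_def] a
      by (simp add: sum_distrib_left mult_ac)
    moreover have "e \<noteq> 0" by (simp add: e_def)
    ultimately show ?thesis using mult_cancel_left by blast
  qed
  also have "?s = (\<Sum>l<k. c l (y - of_nat l) * p (y - of_nat l + 1))"
    by (rule sum.reindex_bij_witness[of _ "\<lambda>l. k - 1 - l" "\<lambda>l. k - 1 - l"])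
       (use x_add in \<open>auto simp del: of_nat_diff\<close>)
  finally have "(\<Sum>l<k. c l (y - of_nat l) * p (y - of_nat l + 1)) + p x = 0" by simp
  \<comment> \<open>As \<open>c k\<close> is 1 on \<open>D\<close>, \<open>p x\<close> is the
    missing summand \<open>l = k\<close> of the conjugate.\<close>
  moreover have "x = y - of_nat k + 1" using a by (simp add: x_def of_nat_diff)
  moreover have "c k (y - of_nat k) = 1"
    using b shift_invariant_diff[OF D y, of k] by (simp add: c_def monic_op_def)
  ultimately have "(\<Sum>l\<le>k. c l (y - of_nat l) * p (y - of_nat l + 1)) = 0"
    by (simp add: lessThan_Suc_atMost[symmetric])
  then show ?thesis
    by (simp add: diff_op_conj_altdef shift_def p_def c_def)
qed

section \<open>Order and leading coefficient of the left factor\<close>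

lemma diff_op_indicator:
  "diff_op N a (\<lambda>z. if z = x + of_nat M then 1 else 0) x = (if M \<le> N then a (N - M) x else 0)"
proof -
  \<comment> \<open>The points \<open>x + of_nat l\<close> are distinct, so the indicator reads off
    one coefficient.\<close>
  have "diff_op N a (\<lambda>z. if z = x + of_nat M then 1 else 0) x =
      (\<Sum>l\<le>N. if l = M then a (N - l) x else 0)"
    unfolding diff_op_altdef by (intro sum.cong) auto
  then show ?thesis by simp
qed

text \<open>In a product of orders \<open>m\<close> and \<open>n\<close> the shift power
  \<open>m + n\<close> arises only from the two leading terms, and no higher power arises.\<close>

lemma diff_op_comp_indicator:
  assumes "m + n \<le> M"
  shows "diff_op m b (diff_op n s (\<lambda>z. if z = x + of_nat M then 1 else 0)) x =
    (if M = m + n then b 0 x * s 0 (x + of_nat m) else 0)"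
proof -
  have "diff_op n s (\<lambda>z. if z = x + of_nat M then 1 else 0) (x + of_nat l) =
      (if l = m \<and> M = m + n then s 0 (x + of_nat m) else 0)" if "l \<le> m" for l
  proof -
    have "(\<lambda>z. if z = x + of_nat M then 1 else 0) =
        (\<lambda>z. if z = (x + of_nat l) + of_nat (M - l) then 1 else (0::complex))"
      using assms that by (simp add: of_nat_diff)
    then show ?thesis using assms that diff_op_indicator[of n s "x + of_nat l" "M - l"] by auto
  qed
  then have "diff_op m b (diff_op n s (\<lambda>z. if z = x + of_nat M then 1 else 0)) x =
      (\<Sum>l\<le>m. if l = m then (if M = m + n then b 0 x * s 0 (x + of_nat m) else 0) else 0)"
    unfolding diff_op_altdef[of m] by (intro sum.cong) auto
  then show ?thesis by simp
qed

text \<open>Compare top coefficients: where \<open>b 0\<close> is nonzero, degree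
  \<open>m + n\<close> must occur in \<open>c\<close>, so \<open>m \<le> k\<close>; the leading 1 of
  \<open>c\<close> excludes \<open>m < k\<close>.\<close>

lemma left_factor_monic:
  assumes D: "shift_invariant D" and s: "monic_op D s" and c: "monic_op D c"
    and b: "leading_nonzero D b" and fac: "op_factorization D (n + k) c m b n s"
  shows "m = k" and "monic_op D b"
proof -
  have s0: "s 0 (x + of_nat m) = 1" if "x \<in> D" for x
    using s shift_invariant_add[OF D that] by (simp add: monic_op_def)
  have coeff: "(if M \<le> n + k then c (n + k - M) x else 0) = (if M = m + n then b 0 x else 0)"
    if "m + n \<le> M" "x \<in> D" for M x
    using fac that diff_op_indicator[of "n + k" c x M] diff_op_comp_indicator[OF that(1), of b s x] s0
    by (auto simp: op_factorization_def)
  obtain x where x: "x \<in> D" "b 0 x \<noteq> 0" using b by (auto simp: leading_nonzero_def)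
  have "m \<le> k" using coeff[of "m + n" x] x by (auto split: if_splits)
  moreover have "\<not> m < k"
    using coeff[of "n + k" x] x c by (auto simp: monic_op_def)
  ultimately show "m = k" by simp
  then show "monic_op D b"
    using coeff[of "m + n"] c by (auto simp: monic_op_def add.commute)
qed

theorem proposition2p4:
  fixes D :: "complex set"
    and fs hs :: "(complex \<Rightarrow> complex) list"
    and n k m :: nat
    and s s_hat s_check :: "nat \<Rightarrow> complex \<Rightarrow> complex"
  assumes "shift_invariant D"
    and "length fs = n"
    and "length hs = k"
    and "\<And>I x. x \<in> D \<Longrightarrow> wronskian (nths (fs @ hs) I) x \<noteq> 0"
    and "monic_op D s"
    and "annihilates D n s fs"
    and "monic_op D s_hat"
    and "annihilates D (n + k) s_hat (fs @ hs)"
    and "leading_nonzero D s_check"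
    and "op_factorization D (n + k) s_hat m s_check n s"
  shows "\<forall>a<k. \<forall>x\<in>D. diff_op_conj m s_check (phi fs hs a) x = 0"
proof (intro allI impI ballI)
  fix a x assume a: "a < k" and x: "x \<in> D"
  note D = assms(1)
  note check = left_factor_monic[OF D assms(5,7,9,10)]
  define gs where "gs = map (diff_op n s) hs"
  have mult: "wronskian (fs @ us) y = wronskian fs y * wronskian (map (diff_op n s) us) y"
    if "y \<in> D" for us y
    using wronskian_append_eq_mult[OF D assms(5) _ that, of fs us] assms(2,6) by simp
  \<comment> \<open>The choice \<open>UNIV\<close> selects the full list, whose Wronskian is the
    product of these two.\<close>
  have fs_nz: "wronskian fs y \<noteq> 0" and gs_nz: "wronskian gs y \<noteq> 0" if "y \<in> D" for y
    using assms(4)[OF that, of UNIV] mult[OF that, of hs] by (auto simp: gs_def nths_all)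
  \<comment> \<open>Applying \<open>s_check\<close> to \<open>diff_op n s h\<close> gives
    \<open>s_hat\<close> applied to \<open>h\<close>, which is 0.\<close>
  have "annihilates D k s_check gs"
    using assms(8,10) check(1) by (auto simp: annihilates_def op_factorization_def gs_def)
  then have "diff_op_conj k s_check
      (shift (\<lambda>x. wronskian (take a gs @ drop (Suc a) gs) x / wronskian gs x)) x = 0"
    using diff_op_conj_wronskian_quotient_eq_0[OF D check(2) _ _ a gs_nz x] assms(3)
    by (simp add: gs_def)
  \<comment> \<open>The factor \<open>wronskian fs\<close> cancels at \<open>y + 1\<close>. Equality
    on \<open>D\<close> suffices, since the conjugate only evaluates at backward shifts of
    \<open>x\<close>.\<close>
  moreover have "phi fs hs a y =
      shift (\<lambda>x. wronskian (take a gs @ drop (Suc a) gs) x / wronskian gs x) y" if "y \<in> D" for y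
  proof -
    have "y + 1 \<in> D" using D that by (simp add: shift_invariant_def)
    then show ?thesis
      using fs_nz by (simp add: phi_def shift_def mult gs_def take_map drop_map)
  qed
  ultimately show "diff_op_conj m s_check (phi fs hs a) x = 0"
    using shift_invariant_diff[OF D x] by (simp add: diff_op_conj_altdef check(1))
qed

end
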